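(* Let $z=(x_1,\dots,x_m)\in\Omega^m$ be IID samples with distribution $\mathbb{P}:=\mu/\mu(\Omega)$. For $f\in A^{r,2}_\lambda(U)$ we have the error bound in expectation over the samples $$\mathbb{E}_{\mathbb{P}^m}\left(\|\mathcal{P}f-\mathcal{P}_{j,z}f\|_U^2\right)\lesssim\left(\lambda_j^r+\frac{j}{m}\right)\|f\|^2_{A^{r,2}_\lambda(U)},$$ where the constant in the upper bound depends on $\bar p$, and hence on the fixed operator $\mathcal{P}$.
   Context: $\Omega\subset\mathbb{R}$ is compact, $\mu$ is a finite measure on $\Omega$, $|\Omega|:=\mu(\Omega)$, $U:=L^2_\mu(\Omega)$, and $\mathbb{P}^m$ is the product measure on $\Omega^m$. $K$ is a symmetric, positive definite, bounded, continuous kernel on $\Omega\times\Omega$; $T_K:U\to U$, $(T_Kg)(x)=\int_\Omega K(x,y)g(y)\mu(dy)$, has eigenvalues $\lambda_1\ge\lambda_2\ge\dots>0$ and eigenfunctions $\{u_i\}$ forming an orthonormal basis of $U$ (taken with their continuous representatives). The space $$A^{r,2}_\lambda(U):=\Big\{f\in U\;\Big|\;|f|_{A^{r,2}_\lambda(U)}^2:=\sum_i\lambda_i^{-r}|(f,u_i)_U|^2<\infty\Big\},\qquad \|f\|_{A^{r,2}_\lambda(U)}:=\|f\|_U+|f|_{A^{r,2}_\lambda(U)},$$ is assumed to be continuously embedded in $C(\Omega)\subset U$, so that point evaluations of $f$ make sense. The operator is the compact operator $$\mathcal{P}:=\sum_{i\in\mathbb{N}}p_iu_i\otimes u_i,\quad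 p(x,y)=\sum_{i\in\mathbb{N}}p_iu_i(x)u_i(y),$$ with real nonincreasing coefficients $p_i$ and $\bar p:=\sup_{(x,y)\in\Omega\times\Omega}|p(x,y)|<\infty$, where $(u\otimes v)f:=u(v,f)_U$. With $p_j(x,y):=\sum_{i\le j}p_iu_i(x)u_i(y)$, the sample-dependent approximation is $$(\mathcal{P}_{j,z}f)(x):=\frac{|\Omega|}{m}\sum_{i=1}^mp_j(x,x_i)f(x_i).$$ $a\lesssim b$ means $a\le c\,b$ with a constant $c>0$ independent of $j$ and $m$. *)

theory Defs
  imports "HOL-Probability.Probability"
begin

text \<open>
  Elements of \<open>U = L\<^sup>2(\<mu>)\<close> are represented by square-integrable functions; equality in \<open>U\<close> is
  equality \<open>\<mu>\<close>-almost everywhere.  All spectral sequences are indexed from 0, so \<open>lam i\<close>, \<open>u i\<close>,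
  \<open>p i\<close> stand for \<open>\<lambda>\<^sub>i\<^sub>+\<^sub>1\<close>, \<open>u\<^sub>i\<^sub>+\<^sub>1\<close>, \<open>p\<^sub>i\<^sub>+\<^sub>1\<close> in the usual numbering from 1, and a sum over the first
  \<open>j\<close> indices is a sum over \<open>i < j\<close>.
\<close>

definition L2 :: "real measure \<Rightarrow> (real \<Rightarrow> real) set" where
  "L2 \<mu> = {f \<in> borel_measurable \<mu>. integrable \<mu> (\<lambda>x. (f x)\<^sup>2)}"

definition L2_inner :: "real measure \<Rightarrow> (real \<Rightarrow> real) \<Rightarrow> (real \<Rightarrow> real) \<Rightarrow> real" where
  "L2_inner \<mu> f g = (\<integral>x. f x * g x \<partial>\<mu>)"

definition L2_norm :: "real measure \<Rightarrow> (real \<Rightarrow> real) \<Rightarrow> real" where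
  "L2_norm \<mu> f = sqrt (L2_inner \<mu> f f)"

definition orthonormal_basis_L2 :: "real measure \<Rightarrow> (nat \<Rightarrow> real \<Rightarrow> real) \<Rightarrow> bool" where
  "orthonormal_basis_L2 \<mu> u \<longleftrightarrow>
     (\<forall>i. u i \<in> L2 \<mu>) \<and>
     (\<forall>i k. L2_inner \<mu> (u i) (u k) = (if i = k then 1 else 0)) \<and>
     (\<forall>f\<in>L2 \<mu>.
        (\<lambda>n. L2_norm \<mu> (\<lambda>x. f x - (\<Sum>i<n. L2_inner \<mu> f (u i) * u i x))) \<longlonglongrightarrow> 0)"

text \<open>
  Positive definiteness in the (weak) sense of reproducing kernels.
\<close>

definition positive_definite_kernel :: "real set \<Rightarrow> (real \<Rightarrow> real \<Rightarrow> real) \<Rightarrow> bool" where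
  "positive_definite_kernel \<Omega> K \<longleftrightarrow>
     (\<forall>X (a :: real \<Rightarrow> real). finite X \<and> X \<subseteq> \<Omega> \<longrightarrow>
        0 \<le> (\<Sum>x\<in>X. \<Sum>y\<in>X. a x * a y * K x y))"

definition kernel_op :: "real measure \<Rightarrow> (real \<Rightarrow> real \<Rightarrow> real) \<Rightarrow> (real \<Rightarrow> real) \<Rightarrow> real \<Rightarrow> real" where
  "kernel_op \<mu> K g x = (\<integral>y. K x y * g y \<partial>\<mu>)"

definition A_space ::
  "real measure \<Rightarrow> (nat \<Rightarrow> real) \<Rightarrow> (nat \<Rightarrow> real \<Rightarrow> real) \<Rightarrow> real \<Rightarrow> (real \<Rightarrow> real) set" where
  "A_space \<mu> lam u r =
     {f \<in> L2 \<mu>. summable (\<lambda>i. lam i powr (- r) * \<bar>L2_inner \<mu> f (u i)\<bar>\<^sup>2)}"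

definition A_seminorm ::
  "real measure \<Rightarrow> (nat \<Rightarrow> real) \<Rightarrow> (nat \<Rightarrow> real \<Rightarrow> real) \<Rightarrow> real \<Rightarrow> (real \<Rightarrow> real) \<Rightarrow> real" where
  "A_seminorm \<mu> lam u r f = sqrt (\<Sum>i. lam i powr (- r) * \<bar>L2_inner \<mu> f (u i)\<bar>\<^sup>2)"

definition A_norm ::
  "real measure \<Rightarrow> (nat \<Rightarrow> real) \<Rightarrow> (nat \<Rightarrow> real \<Rightarrow> real) \<Rightarrow> real \<Rightarrow> (real \<Rightarrow> real) \<Rightarrow> real" where
  "A_norm \<mu> lam u r f = L2_norm \<mu> f + A_seminorm \<mu> lam u r f"

text \<open>
  Every class in the space has a continuous representative whose supremum norm is bounded by a
  fixed multiple of the norm of the class.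
\<close>

definition A_embeds_in_C ::
  "real set \<Rightarrow> real measure \<Rightarrow> (nat \<Rightarrow> real) \<Rightarrow> (nat \<Rightarrow> real \<Rightarrow> real) \<Rightarrow> real \<Rightarrow> bool" where
  "A_embeds_in_C \<Omega> \<mu> lam u r \<longleftrightarrow>
     (\<exists>C. \<forall>f\<in>A_space \<mu> lam u r. \<exists>g. continuous_on \<Omega> g \<and> (AE x in \<mu>. f x = g x) \<and>
        (\<forall>x\<in>\<Omega>. \<bar>g x\<bar> \<le> C * A_norm \<mu> lam u r f))"

text \<open>
  \<open>P\<close> is the operator \<open>\<Sum>i. p\<^sub>i u\<^sub>i \<otimes> u\<^sub>i\<close>, the series being taken in the strong operator sense; this
  determines \<open>P f\<close> up to null sets.
\<close>

definition spectral_sum_op ::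
  "real measure \<Rightarrow> (nat \<Rightarrow> real) \<Rightarrow> (nat \<Rightarrow> real \<Rightarrow> real) \<Rightarrow> ((real \<Rightarrow> real) \<Rightarrow> real \<Rightarrow> real) \<Rightarrow> bool" where
  "spectral_sum_op \<mu> p u P \<longleftrightarrow>
     (\<forall>f\<in>L2 \<mu>. P f \<in> L2 \<mu> \<and>
        (\<lambda>n. L2_norm \<mu> (\<lambda>x. P f x - (\<Sum>i<n. p i * L2_inner \<mu> (u i) f * u i x))) \<longlonglongrightarrow> 0)"

definition compact_op_L2 :: "real measure \<Rightarrow> ((real \<Rightarrow> real) \<Rightarrow> real \<Rightarrow> real) \<Rightarrow> bool" where
  "compact_op_L2 \<mu> P \<longleftrightarrow>
     (\<forall>g :: nat \<Rightarrow> real \<Rightarrow> real. (\<forall>n. g n \<in> L2 \<mu>) \<and> (\<exists>C. \<forall>n. L2_norm \<mu> (g n) \<le> C) \<longrightarrow>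
        (\<exists>h\<in>L2 \<mu>. \<exists>s :: nat \<Rightarrow> nat. strict_mono s \<and>
           (\<lambda>n. L2_norm \<mu> (\<lambda>x. P (g (s n)) x - h x)) \<longlonglongrightarrow> 0))"

definition spectral_kernel ::
  "(nat \<Rightarrow> real) \<Rightarrow> (nat \<Rightarrow> real \<Rightarrow> real) \<Rightarrow> real \<Rightarrow> real \<Rightarrow> real" where
  "spectral_kernel p u x y = (\<Sum>i. p i * u i x * u i y)"

definition truncated_kernel ::
  "(nat \<Rightarrow> real) \<Rightarrow> (nat \<Rightarrow> real \<Rightarrow> real) \<Rightarrow> nat \<Rightarrow> real \<Rightarrow> real \<Rightarrow> real" where
  "truncated_kernel p u j x y = (\<Sum>i<j. p i * u i x * u i y)"

definition kernel_sup_finite ::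
  "real set \<Rightarrow> (nat \<Rightarrow> real) \<Rightarrow> (nat \<Rightarrow> real \<Rightarrow> real) \<Rightarrow> bool" where
  "kernel_sup_finite \<Omega> p u \<longleftrightarrow>
     (\<forall>x\<in>\<Omega>. \<forall>y\<in>\<Omega>. summable (\<lambda>i. p i * u i x * u i y)) \<and>
     bdd_above ((\<lambda>(x, y). \<bar>spectral_kernel p u x y\<bar>) ` (\<Omega> \<times> \<Omega>))"

definition kernel_sup :: "real set \<Rightarrow> (nat \<Rightarrow> real) \<Rightarrow> (nat \<Rightarrow> real \<Rightarrow> real) \<Rightarrow> real" where
  "kernel_sup \<Omega> p u = (SUP (x, y)\<in>\<Omega> \<times> \<Omega>. \<bar>spectral_kernel p u x y\<bar>)"

definition sampled_op ::
  "real measure \<Rightarrow> (nat \<Rightarrow> real) \<Rightarrow> (nat \<Rightarrow> real \<Rightarrow> real) \<Rightarrow> nat \<Rightarrow> nat \<Rightarrow> (nat \<Rightarrow> real) \<Rightarrow>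
   (real \<Rightarrow> real) \<Rightarrow> real \<Rightarrow> real" where
  "sampled_op \<mu> p u j m z f x =
     measure \<mu> (space \<mu>) / real m * (\<Sum>i<m. truncated_kernel p u j x (z i) * f (z i))"

definition sample_measure :: "real measure \<Rightarrow> nat \<Rightarrow> (nat \<Rightarrow> real) measure" where
  "sample_measure \<mu> m =
     (\<Pi>\<^sub>M i\<in>{..<m}. scale_measure (1 / emeasure \<mu> (space \<mu>)) \<mu>)"

end

theory Submission
  imports Defs
begin

text \<open>
  Write \<open>f\<^sub>k = (f, u\<^sub>k)\<close>, \<open>V = \<mu>(\<Omega>)\<close> and \<open>Y\<^sub>k = V/m \<Sum>\<^sub>i u\<^sub>k(x\<^sub>i) f(x\<^sub>i)\<close>.  The sampled operator
  maps \<open>f\<close> to \<open>\<Sum>\<^sub>k\<^sub><\<^sub>j p\<^sub>k Y\<^sub>k u\<^sub>k\<close>, that is, the first \<open>j\<close> terms of \<open>P f\<close> with every coefficient \<open>f\<^sub>k\<close> replaced by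
  its Monte Carlo estimate \<open>Y\<^sub>k\<close>.  Since the \<open>u\<^sub>k\<close> are orthonormal, the squared error is exactly
  \<open>\<Sum>\<^sub>k\<^sub>\<ge>\<^sub>j p\<^sub>k\<^sup>2 f\<^sub>k\<^sup>2 + \<Sum>\<^sub>k\<^sub><\<^sub>j p\<^sub>k\<^sup>2 (Y\<^sub>k - f\<^sub>k)\<^sup>2\<close> (\<open>sampling_error_decomposition\<close>).

  The first sum does not depend on the samples.  It is at most \<open>sup p\<^sub>k\<^sup>2\<close> times the \<open>r\<close>-th power of the
  \<open>j\<close>-th largest eigenvalue times the squared seminorm, because \<open>f\<^sub>k\<^sup>2 = \<lambda>\<^sub>k\<^sup>r (\<lambda>\<^sub>k\<^sup>-\<^sup>r f\<^sub>k\<^sup>2)\<close> and \<open>\<lambda>\<^sub>k\<^sup>r\<close> is nonincreasing in \<open>k\<close> when \<open>r \<ge> 0\<close>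
  (\<open>spectral_tail_bound\<close>).  In the second, \<open>Y\<^sub>k\<close> is an unbiased mean of independent copies, so its
  variance is at most \<open>V/m \<integral>u\<^sub>k\<^sup>2 f\<^sup>2 d\<mu>\<close> (\<open>sampled_integral_error\<close>); the embedding into continuous functions
  bounds \<open>f\<close> uniformly by a multiple of its norm, so each of the \<open>j\<close> terms is of order \<open>1/m\<close>.

  Two points lie behind these estimates.  A bound on \<open>p\<^sub>k\<close> through the supremum of the kernel alone comes from the
  diagonal: compactness makes the decreasing sequence \<open>p\<close> accumulate at 0, so all \<open>p\<^sub>k\<close> are nonnegative
  (\<open>compact_spectral_sum_nonneg\<close>), every term of \<open>p(x,x) = \<Sum>\<^sub>k p\<^sub>k u\<^sub>k(x)\<^sup>2\<close> is then at most the supremum,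
  and integration gives a bound on \<open>p\<^sub>k\<close> (\<open>spectral_coefficient_le_kernel_sup\<close>).  And \<open>r \<ge> 0\<close> is forced
  by the embedding: for negative \<open>r\<close> the space is all of \<open>L\<^sup>2\<close> with an equivalent norm, and an
  infinite-dimensional \<open>L\<^sup>2\<close> over a finite measure does not embed into bounded functions
  (\<open>L2_not_embedded_in_Linfty\<close>, \<open>embedding_exponent_nonneg\<close>).
\<close>

section \<open>Square-integrable functions and orthonormal sequences\<close>

lemma L2_mult_integrable:
  assumes "f \<in> L2 \<mu>" "g \<in> L2 \<mu>"
  shows "integrable \<mu> (\<lambda>x. f x * g x)"
proof (rule Bochner_Integration.integrable_bound[where f = "\<lambda>x. (f x)\<^sup>2 + (g x)\<^sup>2"])
  show "integrable \<mu> (\<lambda>x. (f x)\<^sup>2 + (g x)\<^sup>2)"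
    using assms by (auto simp: L2_def)
  show "(\<lambda>x. f x * g x) \<in> borel_measurable \<mu>"
    using assms by (auto simp: L2_def)
  have "\<bar>a * b\<bar> \<le> a\<^sup>2 + b\<^sup>2" for a b :: real
  proof -
    have "0 \<le> (\<bar>a\<bar> - \<bar>b\<bar>)\<^sup>2" by simp
    also have "\<dots> = a\<^sup>2 + b\<^sup>2 - 2 * \<bar>a * b\<bar>"
      by (simp add: power2_diff abs_mult)
    finally show ?thesis by simp
  qed
  then show "AE x in \<mu>. norm (f x * g x) \<le> norm ((f x)\<^sup>2 + (g x)\<^sup>2)"
    by simp
qed

lemma L2_add: "f \<in> L2 \<mu> \<Longrightarrow> g \<in> L2 \<mu> \<Longrightarrow> (\<lambda>x. f x + g x) \<in> L2 \<mu>"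
  using L2_mult_integrable[of f \<mu> g] by (auto simp: L2_def power2_sum mult.assoc)

lemma L2_scale: "f \<in> L2 \<mu> \<Longrightarrow> (\<lambda>x. c * f x) \<in> L2 \<mu>"
  by (auto simp: L2_def power_mult_distrib)

lemma L2_diff: "f \<in> L2 \<mu> \<Longrightarrow> g \<in> L2 \<mu> \<Longrightarrow> (\<lambda>x. f x - g x) \<in> L2 \<mu>"
  using L2_add[of f \<mu> "\<lambda>x. (- 1) * g x"] L2_scale[of g \<mu> "- 1"] by simp

lemma L2_lincomb:
  fixes u :: "nat \<Rightarrow> real \<Rightarrow> real"
  assumes "\<And>i. u i \<in> L2 \<mu>"
  shows "(\<lambda>x. \<Sum>i<n. a i * u i x) \<in> L2 \<mu>"
proof (induction n)
  case 0
  show ?case by (simp add: L2_def)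
next
  case (Suc n)
  show ?case using L2_add[OF Suc L2_scale[OF assms, of "a n" n]] by simp
qed

lemma L2_inner_commute: "L2_inner \<mu> f g = L2_inner \<mu> g f"
  by (simp add: L2_inner_def mult.commute)

lemma L2_inner_diff_left:
  assumes "f \<in> L2 \<mu>" "g \<in> L2 \<mu>" "h \<in> L2 \<mu>"
  shows "L2_inner \<mu> (\<lambda>x. f x - g x) h = L2_inner \<mu> f h - L2_inner \<mu> g h"
  using L2_mult_integrable[OF assms(1,3)] L2_mult_integrable[OF assms(2,3)]
  by (simp add: L2_inner_def left_diff_distrib)

lemma L2_norm_sq: "(L2_norm \<mu> f)\<^sup>2 = L2_inner \<mu> f f"
  by (simp add: L2_norm_def L2_inner_def)

lemma L2_norm_nonneg: "0 \<le> L2_norm \<mu> f"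
  by (simp add: L2_norm_def L2_inner_def)

lemma L2_inner_lincomb_left:
  assumes u: "\<And>i. u i \<in> L2 \<mu>" and h: "h \<in> L2 \<mu>"
  shows "L2_inner \<mu> (\<lambda>x. \<Sum>i<n. a i * u i x) h = (\<Sum>i<n. a i * L2_inner \<mu> (u i) h)"
proof -
  have "L2_inner \<mu> (\<lambda>x. \<Sum>i<n. a i * u i x) h = (\<integral>x. (\<Sum>i<n. a i * (u i x * h x)) \<partial>\<mu>)"
    by (simp add: L2_inner_def sum_distrib_right mult.assoc)
  also have "\<dots> = (\<Sum>i<n. a i * L2_inner \<mu> (u i) h)"
    using L2_mult_integrable[OF u h] by (simp add: L2_inner_def)
  finally show ?thesis .
qed

text \<open>
  Pythagoras' theorem: the error of best approximation in the span of \<open>u\<^sub>0, \<dots>, u\<^sub>n\<^sub>-\<^sub>1\<close> is orthogonal to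
  the deviation of the coefficients from the optimal ones.  Parseval's identity, the identification
  of coefficients from norm convergence, and the exact form of the sampling error are all instances.
\<close>

lemma L2_dist_lincomb:
  fixes u :: "nat \<Rightarrow> real \<Rightarrow> real"
  assumes u: "\<And>i. u i \<in> L2 \<mu>"
    and on: "\<And>i k. L2_inner \<mu> (u i) (u k) = (if i = k then 1 else 0)"
    and g: "g \<in> L2 \<mu>"
  shows "(L2_norm \<mu> (\<lambda>x. g x - (\<Sum>i<n. a i * u i x)))\<^sup>2 =
    L2_inner \<mu> g g - (\<Sum>i<n. (L2_inner \<mu> g (u i))\<^sup>2) + (\<Sum>i<n. (a i - L2_inner \<mu> g (u i))\<^sup>2)"
proof -
  let ?S = "\<lambda>x. \<Sum>i<n. a i * u i x"
  have S: "?S \<in> L2 \<mu>" using u by (rule L2_lincomb)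
  have gS: "L2_inner \<mu> ?S g = (\<Sum>i<n. a i * L2_inner \<mu> g (u i))"
    by (subst L2_inner_lincomb_left[OF u g]) (simp add: L2_inner_commute)
  have Su: "L2_inner \<mu> ?S (u k) = (if k < n then a k else 0)" for k
    by (simp add: L2_inner_lincomb_left[OF u u] on if_distrib cong: if_cong)
  have SS: "L2_inner \<mu> ?S ?S = (\<Sum>i<n. (a i)\<^sup>2)"
  proof -
    have "L2_inner \<mu> ?S ?S = (\<Sum>i<n. a i * L2_inner \<mu> ?S (u i))"
      by (simp add: L2_inner_lincomb_left[OF u S] L2_inner_commute[of \<mu> ?S])
    then show ?thesis by (simp add: Su power2_eq_square)
  qed
  have "(L2_norm \<mu> (\<lambda>x. g x - ?S x))\<^sup>2 =
      L2_inner \<mu> g (\<lambda>x. g x - ?S x) - L2_inner \<mu> ?S (\<lambda>x. g x - ?S x)"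
    unfolding L2_norm_sq by (rule L2_inner_diff_left[OF g S L2_diff[OF g S]])
  also have "\<dots> = L2_inner \<mu> g g - 2 * L2_inner \<mu> ?S g + L2_inner \<mu> ?S ?S"
    using L2_inner_diff_left[OF g S g] L2_inner_diff_left[OF g S S]
    by (simp add: L2_inner_commute[of \<mu> _ "\<lambda>x. g x - ?S x"] L2_inner_commute[of \<mu> g ?S])
  finally show ?thesis
    by (simp add: gS SS power2_diff sum.distrib sum_subtractf sum_distrib_left mult.assoc)
qed

lemma orthonormal_basisD:
  assumes "orthonormal_basis_L2 \<mu> u"
  shows "u i \<in> L2 \<mu>" "L2_inner \<mu> (u i) (u k) = (if i = k then 1 else 0)"
    "f \<in> L2 \<mu> \<Longrightarrow>
      (\<lambda>n. L2_norm \<mu> (\<lambda>x. f x - (\<Sum>i<n. L2_inner \<mu> f (u i) * u i x))) \<longlonglongrightarrow> 0"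
  using assms by (auto simp: orthonormal_basis_L2_def)

lemma parseval:
  assumes onb: "orthonormal_basis_L2 \<mu> u" and g: "g \<in> L2 \<mu>"
  shows "(\<lambda>i. (L2_inner \<mu> g (u i))\<^sup>2) sums L2_inner \<mu> g g"
proof -
  note ob = orthonormal_basisD[OF onb]
  have "(\<lambda>n. (L2_norm \<mu> (\<lambda>x. g x - (\<Sum>i<n. L2_inner \<mu> g (u i) * u i x)))\<^sup>2) \<longlonglongrightarrow> 0\<^sup>2"
    by (intro tendsto_power ob(3) g)
  then have "(\<lambda>n. L2_inner \<mu> g g - (\<Sum>i<n. (L2_inner \<mu> g (u i))\<^sup>2)) \<longlonglongrightarrow> 0"
    by (simp add: L2_dist_lincomb[OF ob(1,2) g])
  then have "(\<lambda>n. L2_inner \<mu> g g - (L2_inner \<mu> g g - (\<Sum>i<n. (L2_inner \<mu> g (u i))\<^sup>2)))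
      \<longlonglongrightarrow> L2_inner \<mu> g g - 0"
    by (intro tendsto_diff tendsto_const)
  then show ?thesis by (simp add: sums_def)
qed

lemma coefficient_le_norm:
  assumes onb: "orthonormal_basis_L2 \<mu> u" and g: "g \<in> L2 \<mu>"
  shows "\<bar>L2_inner \<mu> g (u k)\<bar> \<le> L2_norm \<mu> g"
proof -
  have "(\<Sum>i\<in>{k}. (L2_inner \<mu> g (u i))\<^sup>2) \<le> L2_inner \<mu> g g"
    using parseval[OF assms] by (intro sum_le_suminf[of _ "{k}", THEN order_trans])
      (auto simp: sums_iff)
  then have "(L2_inner \<mu> g (u k))\<^sup>2 \<le> (L2_norm \<mu> g)\<^sup>2"
    by (simp add: L2_norm_sq)
  then show ?thesis
    using L2_norm_nonneg abs_le_square_iff by (metis abs_of_nonneg)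
qed

text \<open>
  By Pythagoras the deviation of the \<open>k\<close>-th coefficient from the optimal one is dominated by every
  approximation error with \<open>n > k\<close>, and these errors tend to 0.
\<close>

lemma coefficient_of_limit:
  assumes onb: "orthonormal_basis_L2 \<mu> u" and g: "g \<in> L2 \<mu>"
    and lim: "(\<lambda>n. L2_norm \<mu> (\<lambda>x. g x - (\<Sum>i<n. a i * u i x))) \<longlonglongrightarrow> 0"
  shows "L2_inner \<mu> g (u k) = a k"
proof -
  note ob = orthonormal_basisD[OF onb]
  have "(a k - L2_inner \<mu> g (u k))\<^sup>2 \<le> (L2_norm \<mu> (\<lambda>x. g x - (\<Sum>i<n. a i * u i x)))\<^sup>2"
    if "n \<ge> Suc k" for n
  proof -
    have "(\<Sum>i<n. (L2_inner \<mu> g (u i))\<^sup>2) \<le> L2_inner \<mu> g g"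
      using parseval[OF onb g] by (intro sum_le_suminf[THEN order_trans]) (auto simp: sums_iff)
    moreover have "(\<Sum>i\<in>{k}. (a i - L2_inner \<mu> g (u i))\<^sup>2) \<le> (\<Sum>i<n. (a i - L2_inner \<mu> g (u i))\<^sup>2)"
      using that by (intro sum_mono2) auto
    ultimately show ?thesis
      by (simp add: L2_dist_lincomb[OF ob(1,2) g])
  qed
  moreover have "(\<lambda>n. (L2_norm \<mu> (\<lambda>x. g x - (\<Sum>i<n. a i * u i x)))\<^sup>2) \<longlonglongrightarrow> 0\<^sup>2"
    by (intro tendsto_power lim)
  ultimately have "(a k - L2_inner \<mu> g (u k))\<^sup>2 \<le> 0\<^sup>2"
    by (intro LIMSEQ_le_const) blast+
  then show ?thesis by simp
qed

section \<open>The spectral coefficients\<close>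

lemma spectral_sum_op_coefficient:
  assumes onb: "orthonormal_basis_L2 \<mu> u" and P: "spectral_sum_op \<mu> p u P" and f: "f \<in> L2 \<mu>"
  shows "P f \<in> L2 \<mu>" "L2_inner \<mu> (P f) (u k) = p k * L2_inner \<mu> f (u k)"
proof -
  show Pf: "P f \<in> L2 \<mu>" using P f by (simp add: spectral_sum_op_def)
  have "(\<lambda>n. L2_norm \<mu> (\<lambda>x. P f x - (\<Sum>i<n. (p i * L2_inner \<mu> (u i) f) * u i x))) \<longlonglongrightarrow> 0"
    using P f by (simp add: spectral_sum_op_def)
  from coefficient_of_limit[OF onb Pf this, of k]
  show "L2_inner \<mu> (P f) (u k) = p k * L2_inner \<mu> f (u k)" by (simp add: L2_inner_commute)
qed

text \<open>
  Some subsequence of \<open>P u\<^sub>n = p\<^sub>n u\<^sub>n\<close> converges to a limit \<open>h\<close>.  Its \<open>n\<close>-th coefficient \<open>p\<^sub>n\<close> then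
  approaches the \<open>n\<close>-th coefficient of \<open>h\<close>, which tends to 0 by Parseval.  So a
  subsequence of the decreasing sequence \<open>p\<close> tends to 0.
\<close>

lemma compact_spectral_sum_nonneg:
  assumes onb: "orthonormal_basis_L2 \<mu> u" and P: "spectral_sum_op \<mu> p u P"
    and comp: "compact_op_L2 \<mu> P" and dec: "decseq p"
  shows "0 \<le> p n"
proof -
  note ob = orthonormal_basisD[OF onb]
  note co = spectral_sum_op_coefficient[OF onb P]
  have "\<forall>n. L2_norm \<mu> (u n) \<le> 1" by (simp add: L2_norm_def ob(2))
  then obtain h s where h: "h \<in> L2 \<mu>" and s: "strict_mono s"
    and lim: "(\<lambda>n. L2_norm \<mu> (\<lambda>x. P (u (s n)) x - h x)) \<longlonglongrightarrow> 0"
    using comp ob(1) unfolding compact_op_L2_def by blast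
  have bound: "\<bar>p (s n) - L2_inner \<mu> h (u (s n))\<bar> \<le> L2_norm \<mu> (\<lambda>x. P (u (s n)) x - h x)" for n
    using coefficient_le_norm[OF onb L2_diff[OF co(1)[OF ob(1)] h], of "s n" "s n"]
    by (simp add: L2_inner_diff_left[OF co(1)[OF ob(1)] h ob(1)] co(2)[OF ob(1)] ob(2))
  have "(\<lambda>n. p (s n) - L2_inner \<mu> h (u (s n))) \<longlonglongrightarrow> 0"
    by (rule Lim_null_comparison[OF _ lim]) (simp add: bound)
  moreover have "(\<lambda>n. L2_inner \<mu> h (u (s n))) \<longlonglongrightarrow> 0"
  proof -
    have "(\<lambda>i. (L2_inner \<mu> h (u i))\<^sup>2) \<longlonglongrightarrow> 0"
      using parseval[OF onb h] by (intro summable_LIMSEQ_zero) (rule sums_summable)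
    from tendsto_real_sqrt[OF this] have "(\<lambda>i. L2_inner \<mu> h (u i)) \<longlonglongrightarrow> 0"
      by (simp add: tendsto_rabs_zero_iff)
    from LIMSEQ_subseq_LIMSEQ[OF this s] show ?thesis by (simp add: o_def)
  qed
  ultimately have "(\<lambda>n. (p (s n) - L2_inner \<mu> h (u (s n))) + L2_inner \<mu> h (u (s n))) \<longlonglongrightarrow> 0 + 0"
    by (rule tendsto_add)
  then have ps: "(\<lambda>n. p (s n)) \<longlonglongrightarrow> 0" by simp
  have "p (s k) \<le> p n" if "k \<ge> n" for k
    using dec seq_suble[OF s, of k] that decseqD[OF dec, of n "s k"] by linarith
  then show ?thesis
    using ps by (intro LIMSEQ_le_const2[OF ps]) blast
qed

text \<open>
  On the diagonal the kernel is a series of nonnegative terms, each of which is therefore at most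
  the supremum; integrating \<open>p\<^sub>k u\<^sub>k(x)\<^sup>2\<close> removes the eigenfunction.
\<close>

lemma spectral_coefficient_le_kernel_sup:
  assumes fin: "finite_measure \<mu>" and sp: "space \<mu> = \<Omega>"
    and onb: "orthonormal_basis_L2 \<mu> u"
    and nonneg: "\<And>i. 0 \<le> p i" and ks: "kernel_sup_finite \<Omega> p u"
  shows "p k \<le> kernel_sup \<Omega> p u * measure \<mu> \<Omega>"
proof -
  interpret finite_measure \<mu> by fact
  note ob = orthonormal_basisD[OF onb]
  have diag: "p k * (u k x * u k x) \<le> kernel_sup \<Omega> p u" if x: "x \<in> \<Omega>" for x
  proof -
    have sm: "summable (\<lambda>i. p i * u i x * u i x)"
      using ks x by (auto simp: kernel_sup_finite_def)
    have "(\<Sum>i\<in>{k}. p i * u i x * u i x) \<le> spectral_kernel p u x x"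
      unfolding spectral_kernel_def
      by (rule sum_le_suminf[OF sm]) (auto simp: nonneg mult.assoc)
    also have "\<dots> \<le> \<bar>spectral_kernel p u x x\<bar>" by simp
    also have "\<dots> \<le> kernel_sup \<Omega> p u"
      using ks x cSUP_upper[of "(x, x)" "\<Omega> \<times> \<Omega>" "\<lambda>(x, y). \<bar>spectral_kernel p u x y\<bar>"]
      unfolding kernel_sup_def kernel_sup_finite_def by simp
    finally show ?thesis by (simp add: mult.assoc)
  qed
  have "p k = (\<integral>x. p k * (u k x * u k x) \<partial>\<mu>)"
    using ob(2)[of k k] by (simp add: L2_inner_def)
  also have "\<dots> \<le> (\<integral>x. kernel_sup \<Omega> p u \<partial>\<mu>)"
    using L2_mult_integrable[OF ob(1) ob(1), of k k]
    by (intro integral_mono) (auto simp: sp diag)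
  also have "\<dots> = kernel_sup \<Omega> p u * measure \<mu> \<Omega>" by (simp add: sp)
  finally show ?thesis .
qed

section \<open>Nonnegativity of the smoothness exponent\<close>

lemma rational_sequence: "\<exists>q :: nat \<Rightarrow> real. (\<forall>n. q n \<in> \<rat>) \<and> q \<longlonglongrightarrow> y"
  using closure_sequential[of y "\<rat>"] Rats_closure_real by auto

text \<open>
  With \<open>a\<^sub>i = u\<^sub>i(x)\<close> the hypothetical estimate at the point \<open>x\<close> reads
  \<open>\<Sum>\<^sub>i\<^sub><\<^sub>n u\<^sub>i(x)\<^sup>2 \<le> C (\<Sum>\<^sub>i\<^sub><\<^sub>n u\<^sub>i(x)\<^sup>2)\<^sup>1\<^sup>/\<^sup>2\<close>, hence \<open>\<Sum>\<^sub>i\<^sub><\<^sub>n u\<^sub>i(x)\<^sup>2 \<le> C\<^sup>2\<close>, and integration gives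
  \<open>n \<le> C\<^sup>2 \<mu>(\<Omega>)\<close> for every \<open>n\<close>.  The exceptional null set depends on \<open>a\<close>, so the estimate is first
  taken for the countably many rational \<open>a\<close> simultaneously and then extended to real \<open>a\<close> by
  continuity.
\<close>

lemma L2_not_embedded_in_Linfty:
  assumes fin: "finite_measure \<mu>" and onb: "orthonormal_basis_L2 \<mu> u" and C: "0 \<le> C"
    and emb: "\<And>a n. AE x in \<mu>. \<bar>\<Sum>i<n. a i * u i x\<bar> \<le> C * sqrt (\<Sum>i<n. (a i)\<^sup>2)"
  shows False
proof -
  interpret finite_measure \<mu> by fact
  note ob = orthonormal_basisD[OF onb]
  have bound: "real n \<le> C\<^sup>2 * measure \<mu> (space \<mu>)" for n
  proof -
    define A where "A = ({..<n} \<rightarrow>\<^sub>E (\<rat> :: real set))"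
    have "countable A"
      unfolding A_def by (intro countable_PiE) (auto simp: countable_rat)
    then have "AE x in \<mu>. \<forall>a\<in>A. \<bar>\<Sum>i<n. a i * u i x\<bar> \<le> C * sqrt (\<Sum>i<n. (a i)\<^sup>2)"
      using emb by (subst AE_ball_countable) auto
    then have "AE x in \<mu>. (\<Sum>i<n. (u i x)\<^sup>2) \<le> C\<^sup>2"
    proof (rule AE_mp, intro AE_I2 impI)
      fix x assume *: "\<forall>a\<in>A. \<bar>\<Sum>i<n. a i * u i x\<bar> \<le> C * sqrt (\<Sum>i<n. (a i)\<^sup>2)"
      have "\<forall>i. \<exists>q :: nat \<Rightarrow> real. (\<forall>n. q n \<in> \<rat>) \<and> q \<longlonglongrightarrow> u i x"
        using rational_sequence by blast
      \<comment> \<open>rational coefficient vectors approximating \<open>(u\<^sub>0(x), \<dots>, u\<^sub>n\<^sub>-\<^sub>1(x))\<close>\<close>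
      from choice[OF this] obtain q :: "nat \<Rightarrow> nat \<Rightarrow> real"
        where q: "\<And>i k. q i k \<in> \<rat>" "\<And>i. q i \<longlonglongrightarrow> u i x"
        by blast
      have "\<bar>\<Sum>i<n. q i k * u i x\<bar> \<le> C * sqrt (\<Sum>i<n. (q i k)\<^sup>2)" for k
        using *[rule_format, of "\<lambda>i\<in>{..<n}. q i k"] q(1) by (simp add: A_def)
      moreover have "(\<lambda>k. \<bar>\<Sum>i<n. q i k * u i x\<bar>) \<longlonglongrightarrow> \<bar>\<Sum>i<n. u i x * u i x\<bar>"
        by (intro tendsto_intros q)
      moreover have "(\<lambda>k. C * sqrt (\<Sum>i<n. (q i k)\<^sup>2)) \<longlonglongrightarrow> C * sqrt (\<Sum>i<n. (u i x)\<^sup>2)"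
        by (intro tendsto_intros q)
      ultimately have "\<bar>\<Sum>i<n. u i x * u i x\<bar> \<le> C * sqrt (\<Sum>i<n. (u i x)\<^sup>2)"
        by (intro LIMSEQ_le) blast+
      moreover define S where "S = (\<Sum>i<n. (u i x)\<^sup>2)"
      moreover have "S \<ge> 0" unfolding S_def by (intro sum_nonneg) auto
      ultimately have "sqrt S * sqrt S \<le> C * sqrt S" "S \<ge> 0"
        by (auto simp: power2_eq_square)
      then have "sqrt S \<le> C"
        using C by (cases "S = 0") (simp_all add: mult_le_cancel_right del: real_sqrt_mult_self)
      then show "(\<Sum>i<n. (u i x)\<^sup>2) \<le> C\<^sup>2"
        using \<open>S \<ge> 0\<close> C by (simp add: S_def sqrt_le_D)
    qed
    moreover have int: "integrable \<mu> (\<lambda>x. \<Sum>i<n. (u i x)\<^sup>2)"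
      using ob(1) by (auto simp: L2_def)
    ultimately have "(\<integral>x. (\<Sum>i<n. (u i x)\<^sup>2) \<partial>\<mu>) \<le> (\<integral>x. C\<^sup>2 \<partial>\<mu>)"
      by (intro integral_mono_AE) auto
    moreover have "(\<integral>x. (\<Sum>i<n. (u i x)\<^sup>2) \<partial>\<mu>) = (\<Sum>i<n. L2_inner \<mu> (u i) (u i))"
      using ob(1) by (subst Bochner_Integration.integral_sum)
        (auto simp: L2_def L2_inner_def power2_eq_square)
    ultimately show ?thesis by (simp add: ob(2) mult.commute)
  qed
  obtain n where "real n > C\<^sup>2 * measure \<mu> (space \<mu>)" using reals_Archimedean2 by blast
  with bound[of n] show False by simp
qed

text \<open>
  If \<open>r < 0\<close>, the weights \<open>\<lambda>\<^sub>i\<^sup>-\<^sup>r\<close> are bounded by \<open>\<lambda>\<^sub>0\<^sup>-\<^sup>r\<close>, so the norm of the smoothness space is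
  dominated by a multiple of the \<open>L\<^sup>2\<close> norm and the embedding would bound every finite combination of
  the \<open>u\<^sub>i\<close> almost everywhere by a fixed multiple of its \<open>L\<^sup>2\<close> norm.
\<close>

lemma embedding_exponent_nonneg:
  assumes fin: "finite_measure \<mu>" and sp: "space \<mu> = \<Omega>" and onb: "orthonormal_basis_L2 \<mu> u"
    and pos: "\<forall>i. lam i > 0" and dec: "decseq lam"
    and emb: "A_embeds_in_C \<Omega> \<mu> lam u r"
  shows "0 \<le> r"
proof (rule ccontr)
  assume "\<not> 0 \<le> r"
  then have r: "r < 0" by simp
  note ob = orthonormal_basisD[OF onb]
  obtain C where C: "\<forall>f\<in>A_space \<mu> lam u r. \<exists>g. continuous_on \<Omega> g \<and> (AE x in \<mu>. f x = g x) \<and>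
      (\<forall>x\<in>\<Omega>. \<bar>g x\<bar> \<le> C * A_norm \<mu> lam u r f)"
    using emb unfolding A_embeds_in_C_def by blast
  define L where "L = lam 0 powr (- r)"
  define D where "D = \<bar>C\<bar> * (1 + sqrt L)"
  have L: "lam i powr (- r) \<le> L" "0 \<le> L" for i
    using pos r decseqD[OF dec, of 0 i] by (auto simp: L_def less_imp_le intro!: powr_mono2)
  have "AE x in \<mu>. \<bar>\<Sum>i<n. a i * u i x\<bar> \<le> D * sqrt (\<Sum>i<n. (a i)\<^sup>2)" for a :: "nat \<Rightarrow> real" and n
  proof -
    let ?f = "\<lambda>x. \<Sum>i<n. a i * u i x"
    have f: "?f \<in> L2 \<mu>" using ob(1) by (rule L2_lincomb)
    have co: "L2_inner \<mu> ?f (u k) = (if k < n then a k else 0)" for k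
      by (simp add: L2_inner_lincomb_left[OF ob(1,1)] ob(2) if_distrib cong: if_cong)
    let ?s = "\<lambda>i. lam i powr (- r) * \<bar>L2_inner \<mu> ?f (u i)\<bar>\<^sup>2"
    have sums: "?s sums (\<Sum>i<n. lam i powr (- r) * (a i)\<^sup>2)"
      using sums_finite[of "{..<n}" ?s] by (simp add: co)
    then have "?f \<in> A_space \<mu> lam u r"
      using f by (simp add: A_space_def sums_iff)
    from C[rule_format, OF this] obtain g where g: "AE x in \<mu>. ?f x = g x"
        "\<forall>x\<in>\<Omega>. \<bar>g x\<bar> \<le> C * A_norm \<mu> lam u r ?f"
      by blast
    have "L2_inner \<mu> ?f ?f = (\<Sum>i<n. (a i)\<^sup>2)"
      using sums_unique2[OF parseval[OF onb f] sums_finite[of "{..<n}"]] by (simp add: co)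
    then have nf: "L2_norm \<mu> ?f = sqrt (\<Sum>i<n. (a i)\<^sup>2)" by (simp add: L2_norm_def)
    have "A_seminorm \<mu> lam u r ?f = sqrt (\<Sum>i<n. lam i powr (- r) * (a i)\<^sup>2)"
      using sums unfolding A_seminorm_def by (simp add: sums_iff)
    also have "\<dots> \<le> sqrt (L * (\<Sum>i<n. (a i)\<^sup>2))"
      using L by (simp add: sum_distrib_left sum_mono mult_right_mono)
    finally have sf: "A_seminorm \<mu> lam u r ?f \<le> sqrt L * sqrt (\<Sum>i<n. (a i)\<^sup>2)"
      by (simp add: real_sqrt_mult)
    have nn: "0 \<le> A_norm \<mu> lam u r ?f"
      using sums L2_norm_nonneg[of \<mu> ?f]
      by (auto simp: A_norm_def A_seminorm_def sums_iff intro!: add_nonneg_nonneg sum_nonneg)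
    have "C * A_norm \<mu> lam u r ?f \<le> \<bar>C\<bar> * ((1 + sqrt L) * sqrt (\<Sum>i<n. (a i)\<^sup>2))"
      using nn nf sf by (intro mult_mono) (auto simp: A_norm_def algebra_simps)
    then have D: "C * A_norm \<mu> lam u r ?f \<le> D * sqrt (\<Sum>i<n. (a i)\<^sup>2)"
      by (simp add: D_def mult.assoc)
    show ?thesis
    proof (rule AE_mp[OF g(1)], intro AE_I2 impI)
      fix x assume "x \<in> space \<mu>" "?f x = g x"
      then show "\<bar>?f x\<bar> \<le> D * sqrt (\<Sum>i<n. (a i)\<^sup>2)" using g(2) sp D by auto
    qed
  qed
  moreover have "0 \<le> D" by (simp add: D_def L(2))
  ultimately show False using L2_not_embedded_in_Linfty[OF fin onb, of D] by blast
qed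

section \<open>Independent samples\<close>

text \<open>
  Bienayme's identity for centred variables: expanding the square, the mixed terms factor by Fubini
  into products of means, which vanish.
\<close>

lemma iid_sum_second_moment:
  fixes v :: "'a \<Rightarrow> real"
  assumes prob: "prob_space N" and v: "v \<in> borel_measurable N"
    and v2: "integrable N (\<lambda>x. (v x)\<^sup>2)" and mean: "(\<integral>x. v x \<partial>N) = 0"
  shows "integrable (\<Pi>\<^sub>M i\<in>{..<m::nat}. N) (\<lambda>z. (\<Sum>i<m. v (z i))\<^sup>2)"
    and "(\<integral>z. (\<Sum>i<m. v (z i))\<^sup>2 \<partial>(\<Pi>\<^sub>M i\<in>{..<m}. N)) = real m * (\<integral>x. (v x)\<^sup>2 \<partial>N)"
proof -
  interpret N: prob_space N by fact
  interpret PN: product_prob_space "\<lambda>_ :: nat. N" by standard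
  let ?M = "\<Pi>\<^sub>M i\<in>{..<m}. N"
  have vi: "integrable N v"
    using v v2 by (rule N.square_integrable_imp_integrable)
  have *: "integrable ?M (\<lambda>z. v (z i) * v (z l)) \<and>
      (\<integral>z. v (z i) * v (z l) \<partial>?M) = (if i = l then \<integral>x. (v x)\<^sup>2 \<partial>N else 0)"
    if il: "i < m" "l < m" for i l
  proof (cases "i = l")
    case True
    \<comment> \<open>The integrand as a product over all coordinates, with the factor 1 in those that do not occur.\<close>
    let ?F = "\<lambda>k x. if k = i then (v x)\<^sup>2 else 1"
    have F: "integrable N (?F k)" for k using v2 by (cases "k = i") auto
    have "(\<Prod>k<m. ?F k (z k)) = (v (z i))\<^sup>2" for z :: "nat \<Rightarrow> 'a"
      using il by simp
    moreover have "(\<Prod>k<m. \<integral>x. ?F k x \<partial>N) = (\<integral>x. (v x)\<^sup>2 \<partial>N)"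
    proof -
      have "(\<integral>x. ?F k x \<partial>N) = (if k = i then \<integral>x. (v x)\<^sup>2 \<partial>N else 1)" for k
        by (simp add: N.prob_space)
      then show ?thesis using il by simp
    qed
    ultimately show ?thesis
      using PN.product_integrable_prod[of "{..<m}" ?F] PN.product_integral_prod[of "{..<m}" ?F] F True
      by (simp add: power2_eq_square)
  next
    case False
    let ?F = "\<lambda>k x. (if k = i then v x else 1) * (if k = l then v x else 1)"
    have F: "integrable N (?F k)" for k using vi False by (cases "k = i"; cases "k = l") auto
    have "(\<Prod>k<m. ?F k (z k)) = v (z i) * v (z l)" for z :: "nat \<Rightarrow> 'a"
      using il by (simp add: prod.distrib)
    moreover have "(\<Prod>k<m. \<integral>x. ?F k x \<partial>N) = 0"
      using il False mean by (intro prod_zero bexI[of _ i]) auto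
    ultimately show ?thesis
      using PN.product_integrable_prod[of "{..<m}" ?F] PN.product_integral_prod[of "{..<m}" ?F] F False
      by simp
  qed
  have eq: "(\<Sum>i<m. v (z i))\<^sup>2 = (\<Sum>i<m. \<Sum>l<m. v (z i) * v (z l))" for z
    by (simp add: power2_eq_square sum_product)
  show "integrable ?M (\<lambda>z. (\<Sum>i<m. v (z i))\<^sup>2)"
    unfolding eq using * by (intro Bochner_Integration.integrable_sum) auto
  have "(\<integral>z. (\<Sum>i<m. v (z i))\<^sup>2 \<partial>?M) = (\<Sum>i<m. \<Sum>l<m. if i = l then \<integral>x. (v x)\<^sup>2 \<partial>N else 0)"
    unfolding eq using * by (subst Bochner_Integration.integral_sum) (auto intro!: sum.cong)
  then show "(\<integral>z. (\<Sum>i<m. v (z i))\<^sup>2 \<partial>?M) = real m * (\<integral>x. (v x)\<^sup>2 \<partial>N)"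
    by simp
qed

lemma normalized_measure_integral:
  fixes f :: "real \<Rightarrow> real"
  assumes fin: "finite_measure \<mu>" and pos: "0 < measure \<mu> (space \<mu>)" and f: "f \<in> borel_measurable \<mu>"
  defines "N \<equiv> scale_measure (1 / emeasure \<mu> (space \<mu>)) \<mu>"
  shows "prob_space N" "integrable \<mu> f \<Longrightarrow> integrable N f"
    "(\<integral>x. f x \<partial>N) = (\<integral>x. f x \<partial>\<mu>) / measure \<mu> (space \<mu>)"
proof -
  interpret finite_measure \<mu> by fact
  let ?V = "measure \<mu> (space \<mu>)"
  have c: "1 / emeasure \<mu> (space \<mu>) = ennreal (1 / ?V)"
    using pos by (simp add: emeasure_eq_measure divide_ennreal[symmetric])
  have N: "N = density \<mu> (\<lambda>x. ennreal (1 / ?V))"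
    by (rule measure_eqI) (auto simp: N_def c emeasure_density_const)
  show "prob_space N"
    unfolding N_def c using pos
    by (intro prob_spaceI) (simp add: space_scale_measure emeasure_eq_measure ennreal_mult[symmetric])
  show "integrable N f" if "integrable \<mu> f"
    using that unfolding N using pos f by (subst integrable_density) auto
  show "(\<integral>x. f x \<partial>N) = (\<integral>x. f x \<partial>\<mu>) / ?V"
    unfolding N using pos f by (subst integral_density) auto
qed

text \<open>
  The Monte Carlo estimate of \<open>\<integral>w d\<mu>\<close> is unbiased under the normalized measure; its variance is
  computed from the centred integrand \<open>v\<close>, and centring does not increase the second moment.
\<close>

lemma sampled_integral_error:
  fixes w :: "real \<Rightarrow> real"
  assumes fin: "finite_measure \<mu>" and pos: "0 < measure \<mu> (space \<mu>)" and m: "1 \<le> m"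
    and w: "w \<in> borel_measurable \<mu>" and w2: "integrable \<mu> (\<lambda>x. (w x)\<^sup>2)"
  defines "V \<equiv> measure \<mu> (space \<mu>)"
  defines "err \<equiv> \<lambda>z. (V / real m * (\<Sum>i<m. w (z i)) - (\<integral>x. w x \<partial>\<mu>))\<^sup>2"
  shows "integrable (sample_measure \<mu> m) err"
    and "(\<integral>z. err z \<partial>sample_measure \<mu> m) \<le> V / real m * (\<integral>x. (w x)\<^sup>2 \<partial>\<mu>)"
proof -
  interpret finite_measure \<mu> by fact
  define c where "c = (\<integral>x. w x \<partial>\<mu>)"
  define N where "N = scale_measure (1 / emeasure \<mu> (space \<mu>)) \<mu>"
  define v where "v = (\<lambda>x. w x - c / V)"
  note N = normalized_measure_integral[OF fin pos, folded N_def V_def]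
  have V: "V > 0" using pos by (simp add: V_def)
  have wi: "integrable \<mu> w" using w w2 by (rule square_integrable_imp_integrable)
  have v: "v \<in> borel_measurable \<mu>" using w by (simp add: v_def)
  then have vN: "v \<in> borel_measurable N" by (simp add: N_def)
  have v_sq: "(v x)\<^sup>2 = (w x)\<^sup>2 - 2 * (c / V) * w x + (c / V)\<^sup>2" for x
    by (simp add: v_def power2_diff)
  have v2: "integrable \<mu> (\<lambda>x. (v x)\<^sup>2)"
    unfolding v_sq using w2 wi by simp
  then have v2N: "integrable N (\<lambda>x. (v x)\<^sup>2)" using v by (intro N(2)) auto
  have mean: "(\<integral>x. v x \<partial>N) = 0"
  proof -
    have "(\<integral>x. v x \<partial>\<mu>) = c - c / V * V"
      using wi by (simp add: v_def c_def V_def)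
    then show ?thesis using V by (simp add: N(3)[OF v])
  qed
  have var: "(\<integral>x. (v x)\<^sup>2 \<partial>\<mu>) \<le> (\<integral>x. (w x)\<^sup>2 \<partial>\<mu>)"
  proof -
    have "(\<integral>x. (v x)\<^sup>2 \<partial>\<mu>) = (\<integral>x. (w x)\<^sup>2 \<partial>\<mu>) - 2 * (c / V) * c + (c / V)\<^sup>2 * V"
      unfolding v_sq using wi w2 by (simp add: c_def V_def)
    also have "\<dots> = (\<integral>x. (w x)\<^sup>2 \<partial>\<mu>) - c\<^sup>2 / V"
      using V by (simp add: field_simps power2_eq_square)
    finally show ?thesis using V by simp
  qed
  have err: "err z = (V / real m)\<^sup>2 * (\<Sum>i<m. v (z i))\<^sup>2" for z
  proof -
    have "V / real m * (\<Sum>i<m. v (z i)) = V / real m * (\<Sum>i<m. w (z i)) - c"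
      using V m by (simp add: v_def sum_subtractf right_diff_distrib)
    then show ?thesis
      by (simp add: err_def c_def flip: power_mult_distrib)
  qed
  have sm: "sample_measure \<mu> m = (\<Pi>\<^sub>M i\<in>{..<m}. N)"
    by (simp add: sample_measure_def N_def)
  note iid = iid_sum_second_moment[OF N(1)[OF v] vN v2N mean, of m]
  show "integrable (sample_measure \<mu> m) err"
    unfolding sm err using iid(1) by simp
  have "(\<integral>z. err z \<partial>sample_measure \<mu> m) = (V / real m)\<^sup>2 * (real m * ((\<integral>x. (v x)\<^sup>2 \<partial>\<mu>) / V))"
    unfolding sm err using iid(2) N(3)[of "\<lambda>x. (v x)\<^sup>2"] v by simp
  also have "\<dots> = V / real m * (\<integral>x. (v x)\<^sup>2 \<partial>\<mu>)"
    using V m by (simp add: field_simps power2_eq_square)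
  also have "\<dots> \<le> V / real m * (\<integral>x. (w x)\<^sup>2 \<partial>\<mu>)"
    using V var by (intro mult_left_mono) auto
  finally show "(\<integral>z. err z \<partial>sample_measure \<mu> m) \<le> V / real m * (\<integral>x. (w x)\<^sup>2 \<partial>\<mu>)" .
qed

section \<open>Splitting the error\<close>

lemma sampling_error_decomposition:
  assumes onb: "orthonormal_basis_L2 \<mu> u" and P: "spectral_sum_op \<mu> p u P" and f: "f \<in> L2 \<mu>"
  shows "(L2_norm \<mu> (\<lambda>x. P f x - sampled_op \<mu> p u j m z f x))\<^sup>2 =
      (\<Sum>i. (p (i + j) * L2_inner \<mu> f (u (i + j)))\<^sup>2) +
      (\<Sum>k<j. (p k)\<^sup>2 * (measure \<mu> (space \<mu>) / real m * (\<Sum>i<m. u k (z i) * f (z i))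
        - L2_inner \<mu> f (u k))\<^sup>2)"
    and "summable (\<lambda>i. (p i * L2_inner \<mu> f (u i))\<^sup>2)"
proof -
  note ob = orthonormal_basisD[OF onb]
  note co = spectral_sum_op_coefficient[OF onb P f]
  define Y where "Y = (\<lambda>k. measure \<mu> (space \<mu>) / real m * (\<Sum>i<m. u k (z i) * f (z i)))"
  have par: "(\<lambda>i. (p i * L2_inner \<mu> f (u i))\<^sup>2) sums L2_inner \<mu> (P f) (P f)"
    using parseval[OF onb co(1)] by (simp add: co(2))
  then show sm: "summable (\<lambda>i. (p i * L2_inner \<mu> f (u i))\<^sup>2)" by (rule sums_summable)
  have "sampled_op \<mu> p u j m z f x = (\<Sum>k<j. (p k * Y k) * u k x)" for x
  proof -
    have "sampled_op \<mu> p u j m z f x =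
        measure \<mu> (space \<mu>) / real m * (\<Sum>i<m. \<Sum>k<j. p k * u k x * u k (z i) * f (z i))"
      by (simp add: sampled_op_def truncated_kernel_def sum_distrib_right)
    also have "\<dots> = measure \<mu> (space \<mu>) / real m * (\<Sum>k<j. \<Sum>i<m. p k * u k x * u k (z i) * f (z i))"
      by (subst sum.swap) simp
    also have "\<dots> = (\<Sum>k<j. (p k * Y k) * u k x)"
      by (simp add: Y_def sum_distrib_left sum_distrib_right mult_ac)
    finally show ?thesis .
  qed
  then have "(L2_norm \<mu> (\<lambda>x. P f x - sampled_op \<mu> p u j m z f x))\<^sup>2 =
      L2_inner \<mu> (P f) (P f) - (\<Sum>k<j. (p k * L2_inner \<mu> f (u k))\<^sup>2)
      + (\<Sum>k<j. (p k * Y k - p k * L2_inner \<mu> f (u k))\<^sup>2)"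
    by (simp add: L2_dist_lincomb[OF ob(1,2) co(1)] co(2))
  also have "L2_inner \<mu> (P f) (P f) - (\<Sum>k<j. (p k * L2_inner \<mu> f (u k))\<^sup>2)
      = (\<Sum>i. (p (i + j) * L2_inner \<mu> f (u (i + j)))\<^sup>2)"
    using suminf_minus_initial_segment[OF sm, of j] par by (simp add: sums_iff)
  finally show "(L2_norm \<mu> (\<lambda>x. P f x - sampled_op \<mu> p u j m z f x))\<^sup>2 =
      (\<Sum>i. (p (i + j) * L2_inner \<mu> f (u (i + j)))\<^sup>2) +
      (\<Sum>k<j. (p k)\<^sup>2 * (measure \<mu> (space \<mu>) / real m * (\<Sum>i<m. u k (z i) * f (z i))
        - L2_inner \<mu> f (u k))\<^sup>2)"
    by (simp only: Y_def flip: right_diff_distrib power_mult_distrib)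
qed

text \<open>
  The index \<open>j - 1\<close> is that of the \<open>j\<close>-th largest eigenvalue, which dominates all eigenvalues
  belonging to the tail.
\<close>

lemma spectral_tail_bound:
  assumes pos: "\<forall>i. lam i > 0" and dec: "decseq lam" and r: "0 \<le> r" and j: "1 \<le> j"
    and f: "f \<in> A_space \<mu> lam u r"
    and B: "\<And>i. (p i)\<^sup>2 \<le> B"
    and sm: "summable (\<lambda>i. (p i * L2_inner \<mu> f (u i))\<^sup>2)"
  shows "(\<Sum>i. (p (i + j) * L2_inner \<mu> f (u (i + j)))\<^sup>2)
    \<le> B * lam (j - 1) powr r * (A_seminorm \<mu> lam u r f)\<^sup>2"
proof -
  let ?s = "\<lambda>i. lam i powr (- r) * \<bar>L2_inner \<mu> f (u i)\<bar>\<^sup>2"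
  let ?D = "B * lam (j - 1) powr r"
  have s: "summable ?s" using f by (simp add: A_space_def)
  have B0: "0 \<le> B" using B[of 0] zero_le_power2[of "p 0"] by linarith
  have le: "(p (i + j) * L2_inner \<mu> f (u (i + j)))\<^sup>2 \<le> ?D * ?s (i + j)" for i
  proof -
    have l: "lam (i + j) powr r \<le> lam (j - 1) powr r"
      using pos r decseqD[OF dec, of "j - 1" "i + j"] by (intro powr_mono2) (auto simp: less_imp_le)
    have "lam (i + j) powr r * lam (i + j) powr (- r) = 1"
      using pos[rule_format, of "i + j"] by (simp flip: powr_add)
    then have "(p (i + j) * L2_inner \<mu> f (u (i + j)))\<^sup>2 = (p (i + j))\<^sup>2 * (lam (i + j) powr r * ?s (i + j))"
      by (simp add: power_mult_distrib flip: mult.assoc)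
    also have "\<dots> \<le> B * (lam (j - 1) powr r * ?s (i + j))"
      using l B B0 by (intro mult_mono mult_right_mono) auto
    finally show ?thesis by (simp add: mult.assoc)
  qed
  have "(\<Sum>i. (p (i + j) * L2_inner \<mu> f (u (i + j)))\<^sup>2) \<le> (\<Sum>i. ?D * ?s (i + j))"
    using summable_ignore_initial_segment[OF sm, of j] summable_ignore_initial_segment[OF s, of j]
    by (intro suminf_le le summable_mult)
  also have "\<dots> = ?D * (\<Sum>i. ?s (i + j))"
    using summable_ignore_initial_segment[OF s, of j] by (rule suminf_mult)
  also have "\<dots> \<le> ?D * suminf ?s"
    using suminf_minus_initial_segment[OF s, of j] B0
    by (intro mult_left_mono) (auto intro!: sum_nonneg)
  also have "suminf ?s = (A_seminorm \<mu> lam u r f)\<^sup>2"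
    using suminf_nonneg[OF s] by (simp add: A_seminorm_def)
  finally show ?thesis .
qed

theorem corollary8p2:
  fixes \<Omega> :: "real set" and \<mu> :: "real measure" and K :: "real \<Rightarrow> real \<Rightarrow> real"
    and lam :: "nat \<Rightarrow> real" and u :: "nat \<Rightarrow> real \<Rightarrow> real" and r :: real
  assumes "compact \<Omega>"
    and "finite_measure \<mu>" and "space \<mu> = \<Omega>" and "sets \<mu> = sets (restrict_space borel \<Omega>)"
    and "\<forall>x\<in>\<Omega>. \<forall>y\<in>\<Omega>. K x y = K y x"
    and "positive_definite_kernel \<Omega> K"
    and "bounded ((\<lambda>(x, y). K x y) ` (\<Omega> \<times> \<Omega>))"
    and "continuous_on (\<Omega> \<times> \<Omega>) (\<lambda>(x, y). K x y)"
    and "\<forall>i. lam i > 0" and "decseq lam"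
    and "\<forall>i. continuous_on \<Omega> (u i)"
    and "\<forall>i. AE x in \<mu>. kernel_op \<mu> K (u i) x = lam i * u i x"
    and "orthonormal_basis_L2 \<mu> u"
    and "A_embeds_in_C \<Omega> \<mu> lam u r"
  shows "\<exists>c :: real \<Rightarrow> real. (\<forall>b. c b > 0) \<and>
    (\<forall>p P. spectral_sum_op \<mu> p u P \<and> compact_op_L2 \<mu> P \<and> decseq p \<and> kernel_sup_finite \<Omega> p u \<longrightarrow>
      (\<forall>f\<in>A_space \<mu> lam u r. continuous_on \<Omega> f \<longrightarrow>
        (\<forall>j\<ge>1. \<forall>m\<ge>1.
          integrable (sample_measure \<mu> m)
            (\<lambda>z. (L2_norm \<mu> (\<lambda>x. P f x - sampled_op \<mu> p u j m z f x))\<^sup>2) \<and>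
          (\<integral>z. (L2_norm \<mu> (\<lambda>x. P f x - sampled_op \<mu> p u j m z f x))\<^sup>2 \<partial>sample_measure \<mu> m)
            \<le> c (kernel_sup \<Omega> p u) * (lam (j - 1) powr r + real j / real m)
                * (A_norm \<mu> lam u r f)\<^sup>2)))"
proof -
  let ?V = "measure \<mu> (space \<mu>)"
  note fin = assms(2) and sp = assms(3) and pos = assms(9) and dec = assms(10) and onb = assms(13)
  note ob = orthonormal_basisD[OF onb]
  interpret finite_measure \<mu> by fact
  have r: "0 \<le> r"
    using embedding_exponent_nonneg[OF fin sp onb pos dec assms(14)] .
  have V: "0 < ?V"
  proof (rule ccontr)
    assume "\<not> 0 < ?V"
    then have "?V = 0" using measure_nonneg[of \<mu> "space \<mu>"] by linarith
    then have "AE x in \<mu>. False"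
      by (intro AE_I[where N = "space \<mu>"]) (auto simp: emeasure_eq_measure)
    then have "AE x in \<mu>. u 0 x * u 0 x = 0"
      by (rule eventually_mono) simp
    then have "L2_inner \<mu> (u 0) (u 0) = 0"
      unfolding L2_inner_def by (rule integral_eq_zero_AE)
    then show False by (simp add: ob(2))
  qed
  obtain C0 where C0: "\<forall>f\<in>A_space \<mu> lam u r. \<exists>g. continuous_on \<Omega> g \<and> (AE x in \<mu>. f x = g x) \<and>
      (\<forall>x\<in>\<Omega>. \<bar>g x\<bar> \<le> C0 * A_norm \<mu> lam u r f)"
    using assms(14) unfolding A_embeds_in_C_def by blast
  \<comment> \<open>\<open>(b V)\<^sup>2\<close> bounds all \<open>p\<^sub>k\<^sup>2\<close>; the two summands \<open>1\<close> and \<open>V C0\<^sup>2\<close> serve the tail and the variance.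
    The final \<open>+ 1\<close> makes the constant positive also when \<open>b = 0\<close>.\<close>
  define c where "c = (\<lambda>b :: real. (b * ?V)\<^sup>2 * (1 + ?V * C0\<^sup>2) + 1)"
  have cpos: "c b > 0" for b
    unfolding c_def using V by (intro add_nonneg_pos mult_nonneg_nonneg) auto
  have main: "integrable (sample_measure \<mu> m)
        (\<lambda>z. (L2_norm \<mu> (\<lambda>x. P f x - sampled_op \<mu> p u j m z f x))\<^sup>2) \<and>
      (\<integral>z. (L2_norm \<mu> (\<lambda>x. P f x - sampled_op \<mu> p u j m z f x))\<^sup>2 \<partial>sample_measure \<mu> m)
        \<le> c (kernel_sup \<Omega> p u) * (lam (j - 1) powr r + real j / real m) * (A_norm \<mu> lam u r f)\<^sup>2"
    if P: "spectral_sum_op \<mu> p u P" and comp: "compact_op_L2 \<mu> P" and pdec: "decseq p"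
      and ks: "kernel_sup_finite \<Omega> p u" and fA: "f \<in> A_space \<mu> lam u r"
      and j: "1 \<le> j" and m: "1 \<le> m"
    for p P f j m
  proof -
    have f: "f \<in> L2 \<mu>" using fA by (simp add: A_space_def)
    let ?A = "A_norm \<mu> lam u r f"
    define B where "B = (kernel_sup \<Omega> p u * ?V)\<^sup>2"
    define Y where "Y = (\<lambda>k z. (?V / real m * (\<Sum>i<m. u k (z i) * f (z i)) - L2_inner \<mu> f (u k))\<^sup>2)"
    define T where "T = (\<Sum>i. (p (i + j) * L2_inner \<mu> f (u (i + j)))\<^sup>2)"
    have B0: "0 \<le> B" by (simp add: B_def)
    have p0: "0 \<le> p i" for i using compact_spectral_sum_nonneg[OF onb P comp pdec] .
    have pB: "(p i)\<^sup>2 \<le> B" for i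
      using spectral_coefficient_le_kernel_sup[OF fin sp onb p0 ks, of i] p0[of i]
      unfolding B_def by (intro power_mono) (auto simp: sp)
    have "summable (\<lambda>i. lam i powr (- r) * \<bar>L2_inner \<mu> f (u i)\<bar>\<^sup>2)"
      using fA by (simp add: A_space_def)
    then have S0: "0 \<le> A_seminorm \<mu> lam u r f"
      unfolding A_seminorm_def by (auto intro!: suminf_nonneg)
    then have SA: "(A_seminorm \<mu> lam u r f)\<^sup>2 \<le> ?A\<^sup>2"
      using L2_norm_nonneg[of \<mu> f] by (intro power_mono) (auto simp: A_norm_def)
    have split: "(L2_norm \<mu> (\<lambda>x. P f x - sampled_op \<mu> p u j m z f x))\<^sup>2 =
        T + (\<Sum>k<j. (p k)\<^sup>2 * Y k z)" for z
      unfolding T_def Y_def by (rule sampling_error_decomposition(1)[OF onb P f])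
    have "T \<le> B * lam (j - 1) powr r * (A_seminorm \<mu> lam u r f)\<^sup>2"
      unfolding T_def by (rule spectral_tail_bound[OF pos dec r j fA pB sampling_error_decomposition(2)[OF onb P f]])
    also have "\<dots> \<le> B * lam (j - 1) powr r * ?A\<^sup>2"
      using SA B0 by (intro mult_left_mono) auto
    finally have T: "T \<le> B * lam (j - 1) powr r * ?A\<^sup>2" .
    obtain g where g: "AE x in \<mu>. f x = g x" "\<forall>x\<in>\<Omega>. \<bar>g x\<bar> \<le> C0 * ?A"
      using C0[rule_format, OF fA] by blast
    \<comment> \<open>The embedding speaks of a continuous representative, which need agree with \<open>f\<close>
      only outside a null set.\<close>
    have fb: "AE x in \<mu>. (f x)\<^sup>2 \<le> (C0 * ?A)\<^sup>2"
    proof (rule AE_mp[OF g(1)], intro AE_I2 impI)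
      fix x assume "x \<in> space \<mu>" "f x = g x"
      then have "\<bar>f x\<bar> \<le> C0 * ?A" using g(2) sp by auto
      then have "\<bar>f x\<bar>\<^sup>2 \<le> (C0 * ?A)\<^sup>2" by (intro power_mono) auto
      then show "(f x)\<^sup>2 \<le> (C0 * ?A)\<^sup>2" by simp
    qed
    have Y: "integrable (sample_measure \<mu> m) (Y k) \<and>
        (\<integral>z. Y k z \<partial>sample_measure \<mu> m) \<le> ?V / real m * (C0 * ?A)\<^sup>2" for k
    proof -
      let ?w = "\<lambda>x. u k x * f x"
      have w: "?w \<in> borel_measurable \<mu>" using ob(1)[of k] f by (auto simp: L2_def)
      have u2: "integrable \<mu> (\<lambda>x. (C0 * ?A)\<^sup>2 * (u k x)\<^sup>2)" using ob(1)[of k] by (auto simp: L2_def)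
      have le: "AE x in \<mu>. (?w x)\<^sup>2 \<le> (C0 * ?A)\<^sup>2 * (u k x)\<^sup>2"
        using fb by eventually_elim
          (simp only: power_mult_distrib[of "u k _"] mult.commute[of "(u k _)\<^sup>2"], intro mult_right_mono zero_le_power2)
      have w2: "integrable \<mu> (\<lambda>x. (?w x)\<^sup>2)"
        using w le by (intro Bochner_Integration.integrable_bound[OF u2]) auto
      have "(\<integral>x. (?w x)\<^sup>2 \<partial>\<mu>) \<le> (\<integral>x. (C0 * ?A)\<^sup>2 * (u k x)\<^sup>2 \<partial>\<mu>)"
        by (rule integral_mono_AE[OF w2 u2 le])
      also have "\<dots> = (C0 * ?A)\<^sup>2"
        using ob(2)[of k k] by (simp add: L2_inner_def power2_eq_square)
      finally have "?V / real m * (\<integral>x. (?w x)\<^sup>2 \<partial>\<mu>) \<le> ?V / real m * (C0 * ?A)\<^sup>2"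
        by (intro mult_left_mono) auto
      moreover have "L2_inner \<mu> f (u k) = (\<integral>x. ?w x \<partial>\<mu>)"
        by (simp add: L2_inner_def mult.commute)
      ultimately show ?thesis
        using sampled_integral_error[OF fin V m w w2] unfolding Y_def by auto
    qed
    interpret S: prob_space "sample_measure \<mu> m"
      unfolding sample_measure_def
      by (intro prob_space_PiM normalized_measure_integral(1)[OF fin V, of "\<lambda>_. 0"]) simp
    have int: "integrable (sample_measure \<mu> m) (\<lambda>z. T + (\<Sum>k<j. (p k)\<^sup>2 * Y k z))"
      using Y by simp
    have "(\<integral>z. T + (\<Sum>k<j. (p k)\<^sup>2 * Y k z) \<partial>sample_measure \<mu> m)
        = T + (\<Sum>k<j. (p k)\<^sup>2 * (\<integral>z. Y k z \<partial>sample_measure \<mu> m))"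
      using Y by (simp add: S.prob_space)
    also have "(\<Sum>k<j. (p k)\<^sup>2 * (\<integral>z. Y k z \<partial>sample_measure \<mu> m))
        \<le> (\<Sum>k<j. B * (?V / real m * (C0 * ?A)\<^sup>2))"
      using Y pB B0 by (intro sum_mono mult_mono) (auto simp: Y_def)
    also have "\<dots> = B * ?V * C0\<^sup>2 * (real j / real m) * ?A\<^sup>2"
      by (simp add: power_mult_distrib)
    finally have "(\<integral>z. T + (\<Sum>k<j. (p k)\<^sup>2 * Y k z) \<partial>sample_measure \<mu> m)
        \<le> T + B * ?V * C0\<^sup>2 * (real j / real m) * ?A\<^sup>2" by simp
    also have "\<dots> \<le> B * lam (j - 1) powr r * ?A\<^sup>2 + B * ?V * C0\<^sup>2 * (real j / real m) * ?A\<^sup>2"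
      using T by simp
    also have "\<dots> = (B * lam (j - 1) powr r + B * ?V * C0\<^sup>2 * (real j / real m)) * ?A\<^sup>2"
      by (simp only: distrib_right)
    also have "\<dots> \<le> (c (kernel_sup \<Omega> p u) * lam (j - 1) powr r
        + c (kernel_sup \<Omega> p u) * (real j / real m)) * ?A\<^sup>2"
    proof -
      have c_eq: "c (kernel_sup \<Omega> p u) = B + B * ?V * C0\<^sup>2 + 1"
        by (simp add: c_def B_def distrib_left)
      have "0 \<le> B * ?V * C0\<^sup>2" using B0 by simp
      then have "B \<le> c (kernel_sup \<Omega> p u)" "B * ?V * C0\<^sup>2 \<le> c (kernel_sup \<Omega> p u)"
        using B0 unfolding c_eq by linarith+
      then show ?thesis by (intro mult_right_mono add_mono) auto
    qed
    finally show ?thesis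
      using int unfolding split by (simp only: distrib_left)
  qed
  show ?thesis
    by (intro exI[of _ c] conjI allI impI ballI cpos) (use main in blast)+
qed

end
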